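(* A graph $G$ is split if and only if $G$ is almost CIS or $G$ is $\cap$-edge simplicial.
   Context: A graph $G=(V,E)$ is split if $V$ can be partitioned into a clique and a stable set. $G$ is almost CIS if every maximal clique $C$ and every maximal stable set $S$ of $G$ intersect, except for exactly one pair $(C_0,S_0)$. A clique $C$ is simplicial if $C=N[v]$ (closed neighborhood) for some vertex $v$. $G$ is edge simplicial if every edge lies in a simplicial clique; $G$ is $\cap$-edge simplicial if both $G$ and its complement $\overline G$ are edge simplicial. *)

theory Defs
  imports Main
begin

definition graph :: "'a set \<Rightarrow> ('a \<Rightarrow> 'a \<Rightarrow> bool) \<Rightarrow> bool" where
  "graph V E \<longleftrightarrow> finite V \<and> (\<forall>x y. E x y \<longrightarrow> E y x) \<and> (\<forall>x. \<not> E x x)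
     \<and> (\<forall>x y. E x y \<longrightarrow> x \<in> V \<and> y \<in> V)"

definition complement :: "'a set \<Rightarrow> ('a \<Rightarrow> 'a \<Rightarrow> bool) \<Rightarrow> ('a \<Rightarrow> 'a \<Rightarrow> bool)" where
  "complement V E = (\<lambda>x y. x \<in> V \<and> y \<in> V \<and> x \<noteq> y \<and> \<not> E x y)"

definition clique :: "'a set \<Rightarrow> ('a \<Rightarrow> 'a \<Rightarrow> bool) \<Rightarrow> 'a set \<Rightarrow> bool" where
  "clique V E C \<longleftrightarrow> C \<subseteq> V \<and> (\<forall>x\<in>C. \<forall>y\<in>C. x \<noteq> y \<longrightarrow> E x y)"

definition stable :: "'a set \<Rightarrow> ('a \<Rightarrow> 'a \<Rightarrow> bool) \<Rightarrow> 'a set \<Rightarrow> bool" where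
  "stable V E S \<longleftrightarrow> S \<subseteq> V \<and> (\<forall>x\<in>S. \<forall>y\<in>S. \<not> E x y)"

definition maximal_clique :: "'a set \<Rightarrow> ('a \<Rightarrow> 'a \<Rightarrow> bool) \<Rightarrow> 'a set \<Rightarrow> bool" where
  "maximal_clique V E C \<longleftrightarrow> clique V E C \<and> (\<forall>D. clique V E D \<and> C \<subseteq> D \<longrightarrow> D = C)"

definition maximal_stable :: "'a set \<Rightarrow> ('a \<Rightarrow> 'a \<Rightarrow> bool) \<Rightarrow> 'a set \<Rightarrow> bool" where
  "maximal_stable V E S \<longleftrightarrow> stable V E S \<and> (\<forall>T. stable V E T \<and> S \<subseteq> T \<longrightarrow> T = S)"

definition split_graph :: "'a set \<Rightarrow> ('a \<Rightarrow> 'a \<Rightarrow> bool) \<Rightarrow> bool" where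
  "split_graph V E \<longleftrightarrow> (\<exists>K S. K \<union> S = V \<and> K \<inter> S = {} \<and> clique V E K \<and> stable V E S)"

definition almost_CIS :: "'a set \<Rightarrow> ('a \<Rightarrow> 'a \<Rightarrow> bool) \<Rightarrow> bool" where
  "almost_CIS V E \<longleftrightarrow>
     (\<exists>!p. maximal_clique V E (fst p) \<and> maximal_stable V E (snd p) \<and> fst p \<inter> snd p = {})"

definition closed_nbhd :: "'a set \<Rightarrow> ('a \<Rightarrow> 'a \<Rightarrow> bool) \<Rightarrow> 'a \<Rightarrow> 'a set" where
  "closed_nbhd V E v = insert v {u \<in> V. E v u}"

definition simplicial_clique :: "'a set \<Rightarrow> ('a \<Rightarrow> 'a \<Rightarrow> bool) \<Rightarrow> 'a set \<Rightarrow> bool" where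
  "simplicial_clique V E C \<longleftrightarrow> clique V E C \<and> (\<exists>v\<in>V. C = closed_nbhd V E v)"

definition edge_simplicial :: "'a set \<Rightarrow> ('a \<Rightarrow> 'a \<Rightarrow> bool) \<Rightarrow> bool" where
  "edge_simplicial V E \<longleftrightarrow>
     (\<forall>x y. E x y \<longrightarrow> (\<exists>C. simplicial_clique V E C \<and> x \<in> C \<and> y \<in> C))"

definition cap_edge_simplicial :: "'a set \<Rightarrow> ('a \<Rightarrow> 'a \<Rightarrow> bool) \<Rightarrow> bool" where
  "cap_edge_simplicial V E \<longleftrightarrow> edge_simplicial V E \<and> edge_simplicial V (complement V E)"

end

theory Submission
  imports Defs
begin

text \<open>
  The substantial direction is that an almost CIS graph is split. Let \<open>(C, S)\<close> be the unique
  disjoint pair and \<open>U\<close> the set of vertices outside \<open>C \<union> S\<close>. Every other pair of a clique \<open>A\<close>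
  and a stable set \<open>B\<close> is settled: some vertex extends \<open>A\<close> and \<open>B\<close> at the same time. For
  \<open>c \<in> C\<close>, the neighbourhood of \<open>c\<close> either inherits the unique disjoint pair, so that by
  induction \<open>c\<close> has no neighbours in \<open>U\<close>, or \<open>c\<close> has a mate \<open>c' \<in> C\<close> such that no vertex
  outside \<open>C\<close> is adjacent to both; the dual holds for \<open>S\<close>. If some \<open>c \<in> C\<close> has no neighbour
  in \<open>U\<close>, then neither have the neighbours of \<open>c\<close> in \<open>S\<close>, and a mate of such a neighbour
  contradicts the dual statement. Otherwise all vertices of \<open>C \<union> S\<close> have mates, and an unsettled
  pair can be built from any vertex of \<open>U\<close>.

  That a \<open>\<inter>\<close>-edge simplicial graph is split needs no induction. Choose one vertex for each
  simplicial clique and one for each co-simplicial stable set. These choices form a stable set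
  \<open>P\<close> and a clique \<open>Q\<close>. Every vertex \<open>r\<close> lies in \<open>N[p]\<close> and in \<open>V - N(q)\<close> for some
  \<open>p \<in> P\<close> and \<open>q \<in> Q\<close>, and these two sets meet only in \<open>p\<close> or \<open>q\<close>.
\<close>

section \<open>Settled pairs\<close>

text \<open>
  The relation \<open>F\<close> is non-adjacency of distinct vertices. Carrying it as a parameter makes the
  locale literally invariant under complementation, which exchanges \<open>E\<close> with \<open>F\<close> and \<open>C\<close>
  with \<open>S\<close>.
\<close>

locale settled_pair =
  fixes V :: "'a set" and E F :: "'a \<Rightarrow> 'a \<Rightarrow> bool" and C S :: "'a set"
  assumes finV: "finite V"
    and Esym: "E x y \<Longrightarrow> E y x"
    and Fsym: "F x y \<Longrightarrow> F y x"
    and EV: "E x y \<Longrightarrow> x \<in> V \<and> y \<in> V \<and> x \<noteq> y"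
    and FV: "F x y \<Longrightarrow> x \<in> V \<and> y \<in> V \<and> x \<noteq> y"
    and excl: "E x y \<Longrightarrow> \<not> F x y"
    and total: "x \<in> V \<Longrightarrow> y \<in> V \<Longrightarrow> x \<noteq> y \<Longrightarrow> E x y \<or> F x y"
    and CV: "C \<subseteq> V" and SV: "S \<subseteq> V" and disj: "C \<inter> S = {}"
    and clq: "x \<in> C \<Longrightarrow> y \<in> C \<Longrightarrow> x \<noteq> y \<Longrightarrow> E x y"
    and stb: "x \<in> S \<Longrightarrow> y \<in> S \<Longrightarrow> x \<noteq> y \<Longrightarrow> F x y"
    and Cmax: "v \<in> V \<Longrightarrow> v \<notin> C \<Longrightarrow> \<exists>c\<in>C. F v c"
    and Smax: "v \<in> V \<Longrightarrow> v \<notin> S \<Longrightarrow> \<exists>s\<in>S. E v s"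
    and settle: "\<lbrakk>A \<subseteq> V; B \<subseteq> V; \<forall>x\<in>A. \<forall>y\<in>A. x \<noteq> y \<longrightarrow> E x y;
        \<forall>x\<in>B. \<forall>y\<in>B. x \<noteq> y \<longrightarrow> F x y; \<not> (A \<subseteq> C \<and> B \<subseteq> S)\<rbrakk>
      \<Longrightarrow> \<exists>v\<in>V. (\<forall>a\<in>A. a = v \<or> E a v) \<and> (\<forall>b\<in>B. b = v \<or> F b v)"
    and Cmate: "c \<in> C \<Longrightarrow> u \<in> V - (C \<union> S) \<Longrightarrow> E c u
      \<Longrightarrow> \<exists>c'\<in>C. c' \<noteq> c \<and> (\<forall>y\<in>V-C. \<not> (E c y \<and> E c' y))"
    and Smate: "s \<in> S \<Longrightarrow> u \<in> V - (C \<union> S) \<Longrightarrow> F s u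
      \<Longrightarrow> \<exists>s'\<in>S. s' \<noteq> s \<and> (\<forall>y\<in>V-S. \<not> (F s y \<and> F s' y))"
begin

abbreviation U :: "'a set" where "U \<equiv> V - (C \<union> S)"

section \<open>Duality and the extension of cliques into \<open>S\<close>\<close>

lemma dual: "settled_pair V F E S C"
proof unfold_locales
  fix A B :: "'a set"
  assume "A \<subseteq> V" "B \<subseteq> V" "\<forall>x\<in>A. \<forall>y\<in>A. x \<noteq> y \<longrightarrow> F x y"
    "\<forall>x\<in>B. \<forall>y\<in>B. x \<noteq> y \<longrightarrow> E x y" "\<not> (A \<subseteq> S \<and> B \<subseteq> C)"
  then show "\<exists>v\<in>V. (\<forall>a\<in>A. a = v \<or> F a v) \<and> (\<forall>b\<in>B. b = v \<or> E b v)"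
    using settle[of B A] by blast
next
  show "\<exists>c'\<in>S. c' \<noteq> c \<and> (\<forall>y\<in>V - S. \<not> (F c y \<and> F c' y))"
    if "c \<in> S" "u \<in> V - (S \<union> C)" "F c u" for c u
    using Smate[of c u] that by (simp add: Un_commute)
next
  show "\<exists>s'\<in>C. s' \<noteq> s \<and> (\<forall>y\<in>V - C. \<not> (E s y \<and> E s' y))"
    if "s \<in> C" "u \<in> V - (S \<union> C)" "E s u" for s u
    using Cmate[of s u] that by (simp add: Un_commute)
next
  show "\<not> E x y" if "F x y" for x y using excl that by blast
  show "F x y \<or> E x y" if "x \<in> V" "y \<in> V" "x \<noteq> y" for x y using total that by blast
  show "S \<inter> C = {}" using disj by blast
qed (fact finV Esym Fsym EV FV CV SV clq stb Cmax Smax)+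

text \<open>Settling \<open>A\<close> against the whole of \<open>S\<close> gives a vertex with no
  neighbour in \<open>S\<close>, and maximality of \<open>S\<close> forces it into
  \<open>S\<close>.\<close>

lemma clique_extends_into_S:
  assumes "A \<subseteq> V" "\<forall>x\<in>A. \<forall>y\<in>A. x \<noteq> y \<longrightarrow> E x y" "\<not> A \<subseteq> C"
  shows "\<exists>s\<in>S. \<forall>a\<in>A. a = s \<or> E a s"
proof -
  obtain v where v: "v \<in> V" "\<forall>a\<in>A. a = v \<or> E a v" "\<forall>b\<in>S. b = v \<or> F b v"
    using settle[of A S] assms SV stb by blast
  have "v \<in> S"
    using v(1,3) Smax Esym excl EV by metis
  then show ?thesis using v by blast
qed

lemma vertex_with_nbhd_extends_into_S:
  assumes "x \<in> U"
  shows "\<exists>s\<in>S. E x s \<and> (\<forall>a\<in>C. E x a \<longrightarrow> E a s)"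
proof -
  have "\<exists>s\<in>S. \<forall>a\<in>insert x {a\<in>C. E x a}. a = s \<or> E a s"
    by (rule clique_extends_into_S) (use assms CV clq Esym in blast)+
  then show ?thesis
    using assms disj by auto
qed

lemma edge_extends_into_S:
  assumes "E x y" "x \<notin> S" "y \<notin> S" "x \<notin> C"
  shows "\<exists>s\<in>S. E x s \<and> E y s"
proof -
  have "\<exists>s\<in>S. \<forall>a\<in>{x,y}. a = s \<or> E a s"
    by (rule clique_extends_into_S) (use assms EV Esym in blast)+
  then show ?thesis
    using assms by auto
qed

section \<open>Every vertex of \<open>C\<close> has a neighbour in \<open>U\<close>\<close>

text \<open>If \<open>s\<close> and \<open>x\<close> were adjacent, settling them against
  \<open>c0\<close> and its non-neighbours in \<open>S\<close> could only give a vertex of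
  \<open>U\<close> whose neighbours in \<open>S\<close> are all neighbours of \<open>c0\<close>.
  \<open>step2\<close> excludes such a vertex.\<close>

lemma nonadjacent_nbrs_if_anticomplete:
  assumes c0: "c0 \<in> C" "\<forall>u\<in>U. \<not> E c0 u" and s: "s \<in> S" "E c0 s" and x: "x \<in> U"
  shows "F s x"
proof (rule ccontr)
  have step1: "E y c" if t: "t \<in> S" "E c0 t" and y: "y \<in> U" "E y t" and c: "c \<in> C" "F c t"
    for t y c
  proof (rule ccontr)
    assume "\<not> E y c"
    then have Fyc: "F y c" using total[of y c] y c CV by blast
    \<comment> \<open>The clique contains \<open>c0\<close>, so the settling vertex cannot be in
      \<open>U\<close>. In \<open>C\<close> it could only be \<open>c\<close>, in \<open>S\<close>
      only \<open>t\<close>, and neither fits.\<close>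
    have "\<exists>v\<in>V. (\<forall>a\<in>insert t {a\<in>C. E a t}. a = v \<or> E a v) \<and> (\<forall>b\<in>{y,c}. b = v \<or> F b v)"
      by (rule settle) (use t y c CV SV clq Esym Fsym Fyc disj in blast)+
    then obtain v where v: "v \<in> V" "t = v \<or> E t v" "c0 = v \<or> E c0 v"
      "y = v \<or> F y v" "c = v \<or> F c v" using c0 t by blast
    consider "v \<in> C" | "v \<in> S" | "v \<in> U" using v by blast
    then show False
    proof cases
      case 1
      then have "c = v" using v c clq excl EV by metis
      then show ?thesis using v t c excl Esym disj by blast
    next
      case 2
      then have "t = v" using v t stb excl EV by metis
      then show ?thesis using v y excl t by blast
    next
      case 3
      then show ?thesis using v c0 by blast
    qed
  qed
  \<comment> \<open>The witness \<open>s1\<close> absorbs the neighbours of \<open>v\<close> in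
    \<open>C\<close>, while \<open>step1\<close> makes \<open>v\<close> adjacent to a vertex of
    \<open>C\<close> that \<open>s1\<close> misses.\<close>
  have step2: False if v: "v \<in> U" "\<forall>t\<in>S. F c0 t \<longrightarrow> F v t" for v
  proof -
    obtain s1 where s1: "s1 \<in> S" "E v s1" "\<forall>a\<in>C. E v a \<longrightarrow> E a s1"
      using vertex_with_nbhd_extends_into_S[OF v(1)] by blast
    have "E c0 s1" using s1 v excl total[of c0 s1] c0 CV SV disj by blast
    moreover obtain c where "c \<in> C" "F s1 c" using Cmax[of s1] s1 SV disj by blast
    ultimately show False
      using step1[of s1 v c] s1 v excl Fsym by blast
  qed
  assume "\<not> F s x"
  then have Esx: "E s x" using total[of s x] s x SV by blast
  have "\<exists>v\<in>V. (\<forall>a\<in>{s,x}. a = v \<or> E a v) \<and> (\<forall>b\<in>insert c0 {t\<in>S. F c0 t}. b = v \<or> F b v)"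
    by (rule settle) (use s x Esx c0 CV SV stb Esym Fsym disj in blast)+
  then obtain v where v: "v \<in> V" "s = v \<or> E s v" "x = v \<or> E x v" "c0 = v \<or> F c0 v"
    "\<forall>t\<in>S. F c0 t \<longrightarrow> t = v \<or> F t v" by blast
  consider "v \<in> C" | "v \<in> S" | "v \<in> U" using v by blast
  then show False
  proof cases
    case 1
    then have "c0 = v" using v c0 clq excl EV by metis
    then show ?thesis using v x c0 Esym by blast
  next
    case 2
    then have "s = v" using v s stb excl EV by metis
    then show ?thesis using v s c0 excl disj by blast
  next
    case 3
    then show ?thesis using step2[of v] v Fsym by blast
  qed
qed

text \<open>Otherwise a neighbour \<open>s\<close> of \<open>c0\<close> in \<open>S\<close> has no
  neighbour in \<open>U\<close>, so its mate \<open>s'\<close> is adjacent to all of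
  \<open>U\<close>. The preceding lemma contradicts this if \<open>c0\<close> and \<open>s'\<close>
  are adjacent; if not, its dual makes \<open>c0\<close> adjacent to \<open>x\<close>.\<close>

lemma no_anticomplete_vertex:
  assumes c0: "c0 \<in> C" and x: "x \<in> U"
  shows "\<exists>u\<in>U. E c0 u"
proof (rule ccontr)
  assume "\<not> ?thesis"
  then have c0U: "\<forall>u\<in>U. \<not> E c0 u" by blast
  obtain s where s: "s \<in> S" "E c0 s" using Smax[of c0] c0 CV disj by blast
  have "F s x" by (rule nonadjacent_nbrs_if_anticomplete[OF c0 c0U s x])
  then obtain s' where s': "s' \<in> S" "s' \<noteq> s" "\<forall>y\<in>V-S. \<not> (F s y \<and> F s' y)"
    using Smate s x by blast
  have s'U: "\<forall>u\<in>U. \<not> F s' u"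
    using s'(3) nonadjacent_nbrs_if_anticomplete[OF c0 c0U s] by blast
  have xU: "x \<in> V - (S \<union> C)" using x by blast
  show False
  proof (cases "F s' c0")
    case True
    then have "E c0 x"
      using settled_pair.nonadjacent_nbrs_if_anticomplete[OF dual s'(1) _ c0 _ xU] s'U by blast
    then show ?thesis using c0U x by blast
  next
    case False
    then have "E c0 s'" using total[of s' c0] Esym s' c0 CV SV disj by blast
    then show ?thesis
      using nonadjacent_nbrs_if_anticomplete[OF c0 c0U s'(1) _ x] s'U x by blast
  qed
qed

section \<open>Excluding vertices outside \<open>C\<close> and \<open>S\<close>\<close>

text \<open>The condition in \<open>Cmate\<close> now holds for every vertex of \<open>C\<close>, as
  soon as some \<open>x\<close> witnesses that \<open>U\<close> is nonempty.\<close>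

lemma mate_in_C:
  assumes "c \<in> C" "x \<in> U"
  obtains c' where "c' \<in> C" "c' \<noteq> c" "\<And>y. y \<in> V - C \<Longrightarrow> E c y \<Longrightarrow> F c' y"
proof -
  obtain u where "u \<in> U" "E c u" using no_anticomplete_vertex assms by blast
  then obtain c' where c': "c' \<in> C" "c' \<noteq> c" "\<forall>y\<in>V-C. \<not> (E c y \<and> E c' y)"
    using Cmate assms by blast
  show thesis
    by (rule that[of c']) (use c' total[of c'] CV in blast)+
qed

lemma maximal_clique_above:
  assumes "A \<subseteq> V" "\<forall>x\<in>A. \<forall>y\<in>A. x \<noteq> y \<longrightarrow> E x y"
  obtains D where "A \<subseteq> D" "D \<subseteq> V" "\<forall>x\<in>D. \<forall>y\<in>D. x \<noteq> y \<longrightarrow> E x y"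
    "\<forall>v\<in>V. (\<forall>a\<in>D. a = v \<or> E a v) \<longrightarrow> v \<in> D"
proof -
  define X where "X = {D. D \<subseteq> V \<and> (\<forall>x\<in>D. \<forall>y\<in>D. x \<noteq> y \<longrightarrow> E x y)}"
  have "finite X" using finV unfolding X_def by simp
  moreover have "A \<in> X" using assms unfolding X_def by blast
  ultimately obtain D where D: "D \<in> X" "A \<subseteq> D" "\<forall>D'\<in>X. D \<subseteq> D' \<longrightarrow> D = D'"
    using finite_has_maximal2[of X A] by blast
  show thesis
  proof (rule that[of D])
    have "v \<in> D" if v: "v \<in> V" "\<forall>a\<in>D. a = v \<or> E a v" for v
    proof -
      have "\<forall>a\<in>D. a = v \<or> E v a" using v Esym by blast
      then have "insert v D \<in> X" using D(1) v unfolding X_def by auto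
      then show ?thesis using D(3) by blast
    qed
    then show "\<forall>v\<in>V. (\<forall>a\<in>D. a = v \<or> E a v) \<longrightarrow> v \<in> D" by blast
  qed (use D(1,2) in \<open>auto simp: X_def\<close>)
qed

text \<open>Mates \<open>c'\<close> of \<open>c\<close> and \<open>s'\<close> of a neighbour
  \<open>s\<close> of \<open>c\<close> lead to a maximal clique \<open>D\<close> through
  \<open>s\<close> and a stable set through \<open>c'\<close> and \<open>x\<close> that no vertex of
  \<open>D\<close> extends. If \<open>D\<close> meets \<open>U\<close>, a further vertex
  \<open>u\<close> is put into the stable set to block that part of \<open>D\<close>.\<close>

lemma no_subordinate_vertex:
  assumes x: "x \<in> U" and c: "c \<in> C" and Fxc: "F x c"
    and sub: "\<And>b. b \<in> S \<Longrightarrow> F c b \<Longrightarrow> F x b"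
  shows False
proof -
  obtain c' where c': "c' \<in> C" "c' \<noteq> c" and mc: "\<And>y. y \<in> V - C \<Longrightarrow> E c y \<Longrightarrow> F c' y"
    using mate_in_C[OF c x] by blast
  obtain s where s: "s \<in> S" "E c s" using Smax[of c] c CV disj by blast
  have xU: "x \<in> V - (S \<union> C)" using x by blast
  obtain s' where s': "s' \<in> S" "s' \<noteq> s" and ms: "\<And>y. y \<in> V - S \<Longrightarrow> F s y \<Longrightarrow> E s' y"
    using settled_pair.mate_in_C[OF dual s(1) xU] by blast
  have CS: "\<And>a. a \<in> C \<Longrightarrow> a \<in> V - S" "\<And>a. a \<in> S \<Longrightarrow> a \<in> V - C" using CV SV disj by blast+
  have Fc's: "F c' s" using mc s CS by blast
  have Ec's': "E c' s'" using ms[of c'] Fc's Fsym Esym CS c' by blast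
  have Fcs': "F c s'" using total[of c s'] mc[of s'] Ec's' excl CS c s' by blast
  have Exs: "E x s"
    using total[of s x] ms[of x] sub[OF s'(1) Fcs'] excl Esym Fsym x s SV by blast
  \<comment> \<open>By \<open>sub\<close>, a neighbour of \<open>x\<close> in \<open>S\<close> is a
    neighbour of \<open>c\<close>, hence not of its mate \<open>c'\<close>.\<close>
  have not_both: False if "t \<in> S" "E x t" "E c' t" for t
    using that sub[of t] total[of c t] mc[of t] excl CS c by blast
  have Fxc': "F x c'"
    using edge_extends_into_S[of x c'] not_both x c' CS total[of x c'] by blast
  let ?A = "insert s {a\<in>C. E a s}"
  have A: "?A \<subseteq> V" "\<forall>x\<in>?A. \<forall>y\<in>?A. x \<noteq> y \<longrightarrow> E x y"
    using s SV CV clq Esym by blast+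
  obtain D where D: "?A \<subseteq> D" "D \<subseteq> V" "\<forall>x\<in>D. \<forall>y\<in>D. x \<noteq> y \<longrightarrow> E x y"
    and Dmax: "\<forall>v\<in>V. (\<forall>a\<in>D. a = v \<or> E a v) \<longrightarrow> v \<in> D"
    using maximal_clique_above[OF A] .
  have DS: "v = s" if "v \<in> D" "v \<in> S" for v
    using D that s stb[of v s] excl by blast
  have D_adj_s: "E v s" if "v \<in> D" "v \<notin> S" for v
  proof -
    have "s \<in> D" "v \<noteq> s" using D(1) that s by blast+
    then show ?thesis using D(3) that by blast
  qed
  have D_notin_C: "\<not> D \<subseteq> C" using D s CS by blast
  let ?Q = "D \<inter> U"
  have Qs: "E q s" if "q \<in> ?Q" for q using that D_adj_s by blast
  \<comment> \<open>A non-edge between \<open>q\<close> and \<open>s'\<close> would extend by some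
    \<open>c1\<close> of \<open>C\<close>. The mate property makes \<open>c1\<close> a neighbour of
    \<open>s\<close>, hence a member of \<open>D\<close> that \<open>q\<close> misses.\<close>
  have Qs': "E q s'" if q: "q \<in> ?Q" for q
  proof (rule ccontr)
    assume "\<not> E q s'"
    then have "F q s'" using total[of q s'] q s' SV by blast
    then obtain c1 where c1: "c1 \<in> C" "F q c1" "F s' c1"
      using settled_pair.edge_extends_into_S[OF dual, of q s'] settled_pair.edge_extends_into_S[OF dual, of s' q]
        q s' CS by blast
    then have "E s c1" using ms[of c1] total[of s c1] excl CS s by blast
    then have "c1 \<in> D" using D c1 Esym by blast
    moreover have "q \<in> D" "q \<noteq> c1" using q c1 by blast+
    ultimately show False using D(3) c1(2) excl by blast
  qed
  have Qc': "F q c'" if q: "q \<in> ?Q" for q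
  proof -
    have "c \<in> D" "q \<in> D" "c \<noteq> q" using D(1) c s q by blast+
    then have "E c q" using D(3) by blast
    then show ?thesis using mc[of q] q Fsym by blast
  qed
  have c'D: "c' \<notin> D" using D_adj_s CS c' Fc's excl by blast
  show False
  proof (cases "?Q = {}")
    case True
    \<comment> \<open>A settling vertex would belong to \<open>D\<close>. Its members in
      \<open>C\<close> are adjacent to \<open>c'\<close>, its only member in \<open>S\<close> is
      \<open>s\<close>, which is adjacent to \<open>x\<close>, and none is in
      \<open>U\<close>.\<close>
    have "\<exists>v\<in>V. (\<forall>a\<in>D. a = v \<or> E a v) \<and> (\<forall>b\<in>{c',x}. b = v \<or> F b v)"
    proof (rule settle[OF D(2) _ D(3)])
      show "\<forall>y\<in>{c',x}. \<forall>z\<in>{c',x}. y \<noteq> z \<longrightarrow> F y z" using Fxc' Fsym by blast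
    qed (use D_notin_C c' x CV in blast)+
    then obtain v where v: "v \<in> D" "c' = v \<or> F c' v" "x = v \<or> F x v" using Dmax by blast
    consider "v \<in> C" | "v \<in> S" | "v \<in> U" using v D by blast
    then show False
    proof cases
      case 1
      then show ?thesis using v c' c'D clq[of c' v] excl by blast
    next
      case 2
      then show ?thesis using v DS Exs excl EV by blast
    next
      case 3
      then show ?thesis using v True by blast
    qed
  next
    case False
    then obtain q where q: "q \<in> ?Q" by blast
    \<comment> \<open>This pair produces the blocking vertex \<open>u\<close>: it will lie in
      \<open>U\<close>, be adjacent to all of \<open>D \<inter> U\<close>, and miss
      \<open>c'\<close> and every vertex of \<open>S\<close> that \<open>c'\<close> misses.\<close>
    have "\<exists>v\<in>V. (\<forall>a\<in>insert s' ?Q. a = v \<or> E a v)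
        \<and> (\<forall>b\<in>insert c' {t\<in>S. F c' t}. b = v \<or> F b v)"
    proof (rule settle)
      show "\<forall>x\<in>insert s' ?Q. \<forall>y\<in>insert s' ?Q. x \<noteq> y \<longrightarrow> E x y"
        using D(3) Qs' Esym by blast
      show "\<forall>x\<in>insert c' {t\<in>S. F c' t}. \<forall>y\<in>insert c' {t\<in>S. F c' t}. x \<noteq> y \<longrightarrow> F x y"
        using stb Fsym by blast
    qed (use s' c' CS SV in blast)+
    then obtain u where u: "u \<in> V" "s' = u \<or> E s' u" "\<forall>a\<in>?Q. a = u \<or> E a u"
      "c' = u \<or> F c' u" "\<forall>t\<in>S. F c' t \<longrightarrow> t = u \<or> F t u" by blast
    have "u \<notin> C"
    proof
      assume "u \<in> C"
      then have "c' = u" using u c' clq[of c' u] excl by blast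
      then show False using u(3) q Qc'[OF q] excl FV by blast
    qed
    moreover have "u \<notin> S"
    proof
      assume "u \<in> S"
      then have "s' = u" using u s' stb[of s' u] excl by blast
      then show False using u(4) Ec's' excl EV by blast
    qed
    ultimately have uU: "u \<in> U" using u by blast
    have Fus: "F u s" using u(5) s Fc's uU Fsym by blast
    have Fuc': "F u c'" using u(4) uU c' Fsym by blast
    have EQu: "E a u" if "a \<in> ?Q" for a
    proof -
      have "a \<noteq> u" using Qs[OF that] Fus excl by blast
      then show ?thesis using u(3) that by blast
    qed
    have "u \<noteq> x" using Fus Exs excl by blast
    have Fux: "F u x"
    proof (rule ccontr)
      assume "\<not> F u x"
      then have "E u x" using total[of u x] u x \<open>u \<noteq> x\<close> by blast
      then obtain t where t: "t \<in> S" "E u t" "E x t"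
        using edge_extends_into_S[of u x] uU x by blast
      \<comment> \<open>A neighbour of \<open>u\<close> in \<open>S\<close> cannot be a
        non-neighbour of \<open>c'\<close>, by the choice of \<open>u\<close>.\<close>
      have "E c' t" using u(5) t excl Esym total[of c' t] c' CS uU by blast
      then show False using not_both t by blast
    qed
    have "\<exists>v\<in>V. (\<forall>a\<in>D. a = v \<or> E a v) \<and> (\<forall>b\<in>{c',x,u}. b = v \<or> F b v)"
    proof (rule settle[OF D(2) _ D(3)])
      show "\<forall>y\<in>{c',x,u}. \<forall>z\<in>{c',x,u}. y \<noteq> z \<longrightarrow> F y z" using Fxc' Fux Fuc' Fsym by blast
    qed (use D_notin_C c' x u CV in blast)+
    then obtain v where v: "v \<in> D" "c' = v \<or> F c' v" "x = v \<or> F x v" "u = v \<or> F u v"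
      using Dmax by blast
    consider "v \<in> C" | "v \<in> S" | "v \<in> U" using v D by blast
    then show False
    proof cases
      case 1
      then show ?thesis using v c' c'D clq[of c' v] excl by blast
    next
      case 2
      then show ?thesis using v DS Exs excl EV by blast
    next
      case 3
      then show ?thesis using v(1,4) EQu[of v] excl EV Esym by blast
    qed
  qed
qed

text \<open>The clique formed by \<open>s\<close>, \<open>x\<close> and the neighbours of
  \<open>x\<close> in \<open>C\<close> is settled against \<open>c\<close> and its non-neighbours in
  \<open>S\<close>. The edge between \<open>c\<close> and \<open>s\<close> and the non-edge between
  \<open>x\<close> and \<open>c\<close> push the settling vertex into \<open>U\<close>, where it is
  forbidden by \<open>no_subordinate_vertex\<close>.\<close>

lemma no_vertex_if_adjacent_witnesses:
  assumes x: "x \<in> U" and s: "s \<in> S" "E x s" "\<forall>a\<in>C. E x a \<longrightarrow> E a s"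
    and c: "c \<in> C" "F x c" and Ecs: "E c s"
  shows False
proof -
  have "\<exists>v\<in>V. (\<forall>a\<in>insert s (insert x {a\<in>C. E x a}). a = v \<or> E a v)
      \<and> (\<forall>b\<in>insert c {t\<in>S. F c t}. b = v \<or> F b v)"
  proof (rule settle)
    show "\<forall>y\<in>insert s (insert x {a\<in>C. E x a}). \<forall>z\<in>insert s (insert x {a\<in>C. E x a}).
        y \<noteq> z \<longrightarrow> E y z" using s clq Esym by blast
    show "\<forall>y\<in>insert c {t\<in>S. F c t}. \<forall>z\<in>insert c {t\<in>S. F c t}. y \<noteq> z \<longrightarrow> F y z"
      using stb Fsym by blast
  qed (use s x c CV SV in blast)+
  then obtain v where v: "v \<in> V" "s = v \<or> E s v" "x = v \<or> E x v" "c = v \<or> F c v"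
    "\<forall>t\<in>S. F c t \<longrightarrow> t = v \<or> F t v" by blast
  have "v \<notin> C"
  proof
    assume "v \<in> C"
    then have "c = v" using v c clq[of c v] excl by blast
    then show False using v c x excl by blast
  qed
  moreover have "v \<notin> S"
  proof
    assume "v \<in> S"
    then have "s = v" using v s stb[of s v] excl by blast
    then show False using v Ecs excl EV by blast
  qed
  ultimately have "v \<in> U" using v by blast
  then show False using no_subordinate_vertex[of v c] v c Fsym by blast
qed

text \<open>A vertex \<open>x\<close> of \<open>U\<close> yields a witness \<open>s\<close> and,
  dually, a witness \<open>c\<close>. Adjacency of \<open>c\<close> and \<open>s\<close> decides
  whether the preceding lemma or its dual applies.\<close>

theorem covers: "V = C \<union> S"
proof (rule ccontr)
  assume "V \<noteq> C \<union> S"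
  then obtain x where x: "x \<in> U" using CV SV by blast
  then have x': "x \<in> V - (S \<union> C)" by blast
  obtain s where s: "s \<in> S" "E x s" "\<forall>a\<in>C. E x a \<longrightarrow> E a s"
    using vertex_with_nbhd_extends_into_S[OF x] by blast
  obtain c where c: "c \<in> C" "F x c" "\<forall>b\<in>S. F x b \<longrightarrow> F b c"
    using settled_pair.vertex_with_nbhd_extends_into_S[OF dual x'] by blast
  have "E c s \<or> F s c" using total[of c s] c s CV SV disj Fsym by blast
  then show False
    using no_vertex_if_adjacent_witnesses[OF x s c(1,2)]
      settled_pair.no_vertex_if_adjacent_witnesses[OF dual x' c s(1,2)] by blast
qed

end

section \<open>Almost CIS graphs are split\<close>

lemma graph_complement: "graph V E \<Longrightarrow> graph V (complement V E)"
  unfolding graph_def complement_def by blast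

lemma complement_complement: "graph V E \<Longrightarrow> complement V (complement V E) = E"
  unfolding graph_def complement_def by blast

lemma clique_complement: "graph V E \<Longrightarrow> clique V (complement V E) A \<longleftrightarrow> stable V E A"
  unfolding graph_def complement_def clique_def stable_def by (metis subsetD)

lemma stable_complement: "graph V E \<Longrightarrow> stable V (complement V E) A \<longleftrightarrow> clique V E A"
  using clique_complement[OF graph_complement] complement_complement by metis

lemma maximal_clique_complement:
  "graph V E \<Longrightarrow> maximal_clique V (complement V E) A \<longleftrightarrow> maximal_stable V E A"
  by (simp add: maximal_clique_def maximal_stable_def clique_complement)

lemma maximal_stable_complement:
  "graph V E \<Longrightarrow> maximal_stable V (complement V E) A \<longleftrightarrow> maximal_clique V E A"
  by (simp add: maximal_clique_def maximal_stable_def stable_complement)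

lemma maximal_clique_iff:
  assumes "graph V E"
  shows "maximal_clique V E D \<longleftrightarrow> clique V E D \<and> (\<forall>v\<in>V. (\<forall>a\<in>D. a = v \<or> E a v) \<longrightarrow> v \<in> D)"
proof
  assume D: "maximal_clique V E D"
  have "v \<in> D" if v: "v \<in> V" "\<forall>a\<in>D. a = v \<or> E a v" for v
  proof -
    have "clique V E (insert v D)"
      using D v assms unfolding maximal_clique_def clique_def graph_def
      by (metis insert_iff insert_subset)
    then show ?thesis using D unfolding maximal_clique_def by blast
  qed
  then show "clique V E D \<and> (\<forall>v\<in>V. (\<forall>a\<in>D. a = v \<or> E a v) \<longrightarrow> v \<in> D)"
    using D unfolding maximal_clique_def by blast
next
  assume D: "clique V E D \<and> (\<forall>v\<in>V. (\<forall>a\<in>D. a = v \<or> E a v) \<longrightarrow> v \<in> D)"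
  then show "maximal_clique V E D"
    unfolding maximal_clique_def clique_def by blast
qed

lemma maximal_stable_iff:
  assumes "graph V E"
  shows "maximal_stable V E T \<longleftrightarrow> stable V E T \<and> (\<forall>v\<in>V. (\<forall>a\<in>T. \<not> E a v) \<longrightarrow> v \<in> T)"
  using maximal_clique_iff[OF graph_complement[OF assms], of T] assms
  unfolding maximal_clique_complement[OF assms] clique_complement[OF assms]
  unfolding graph_def complement_def stable_def by (smt (verit) subsetD)

lemma clique_extends:
  assumes "graph V E" "clique V E A"
  obtains D where "maximal_clique V E D" "A \<subseteq> D"
proof -
  have "finite (Collect (clique V E))"
    by (rule finite_subset[of _ "Pow V"]) (use assms in \<open>auto simp: clique_def graph_def\<close>)
  then obtain D where "D \<in> Collect (clique V E)" "A \<subseteq> D"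
    "\<forall>D'\<in>Collect (clique V E). D \<subseteq> D' \<longrightarrow> D = D'"
    using finite_has_maximal2[of "Collect (clique V E)" A] assms by blast
  then have "maximal_clique V E D" unfolding maximal_clique_def by blast
  then show thesis using that \<open>A \<subseteq> D\<close> by blast
qed

lemma stable_extends:
  assumes "graph V E" "stable V E A"
  obtains T where "maximal_stable V E T" "A \<subseteq> T"
  using clique_extends[OF graph_complement[OF assms(1)], of A] assms
  by (metis clique_complement maximal_clique_complement)

text \<open>Naming both members of the exceptional pair allows the induction to speak about them and
  complementation to exchange them.\<close>

definition unique_disjoint_pair ::
  "'a set \<Rightarrow> ('a \<Rightarrow> 'a \<Rightarrow> bool) \<Rightarrow> 'a set \<Rightarrow> 'a set \<Rightarrow> bool" where
  "unique_disjoint_pair V E C S \<longleftrightarrow> maximal_clique V E C \<and> maximal_stable V E S \<and> C \<inter> S = {}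
     \<and> (\<forall>D T. maximal_clique V E D \<and> maximal_stable V E T \<and> D \<inter> T = {} \<longrightarrow> D = C \<and> T = S)"

lemma unique_disjoint_pair_complement:
  assumes "graph V E" "unique_disjoint_pair V E C S"
  shows "unique_disjoint_pair V (complement V E) S C"
  using assms
  by (auto simp: unique_disjoint_pair_def maximal_clique_complement maximal_stable_complement)

lemma almost_CIS_iff: "almost_CIS V E \<longleftrightarrow> (\<exists>C S. unique_disjoint_pair V E C S)"
  unfolding almost_CIS_def unique_disjoint_pair_def Ex1_def by auto

text \<open>Maximal extensions of \<open>A\<close> and \<open>B\<close> are not the exceptional
  pair, so they meet, and a common vertex settles \<open>A\<close> and \<open>B\<close>.\<close>

lemma pair_is_settled:
  assumes G: "graph V E" and P: "unique_disjoint_pair V E C S"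
    and A: "clique V E A" and B: "stable V E B" and n: "\<not> (A \<subseteq> C \<and> B \<subseteq> S)"
  shows "\<exists>v\<in>V. (\<forall>a\<in>A. a = v \<or> E a v) \<and> (\<forall>b\<in>B. b = v \<or> complement V E b v)"
proof -
  obtain D where D: "maximal_clique V E D" "A \<subseteq> D" using clique_extends[OF G A] by blast
  obtain T where T: "maximal_stable V E T" "B \<subseteq> T" using stable_extends[OF G B] by blast
  obtain v where "v \<in> D \<inter> T"
    using P D T n unfolding unique_disjoint_pair_def by blast
  then have "v \<in> V \<and> (\<forall>a\<in>A. a = v \<or> E a v) \<and> (\<forall>b\<in>B. b = v \<or> complement V E b v)"
    using D T unfolding maximal_clique_def clique_def maximal_stable_def stable_def
      complement_def by (meson IntE subsetD)
  then show ?thesis by blast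
qed

text \<open>Restrict the pair to the neighbourhood \<open>H\<close> of \<open>c\<close>. If it
  remained a unique disjoint pair, induction would cover \<open>H\<close>, contrary to
  \<open>u\<close>. The only property that can fail is maximality of \<open>S \<inter> H\<close>,
  and a vertex witnessing that failure is the mate.\<close>

lemma mate_exists:
  fixes V :: "'a set"
  assumes G: "graph V E" and P: "unique_disjoint_pair V E C S"
    and IH: "\<And>(V' :: 'a set) E' C' S'. card V' < card V \<Longrightarrow> graph V' E'
      \<Longrightarrow> unique_disjoint_pair V' E' C' S' \<Longrightarrow> V' = C' \<union> S'"
    and c: "c \<in> C" and u: "u \<in> V - (C \<union> S)" "E c u"
  shows "\<exists>c'\<in>C. c' \<noteq> c \<and> (\<forall>y\<in>V-C. \<not> (E c y \<and> E c' y))"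
proof -
  define H where "H = {y\<in>V. E c y}"
  define E' where "E' = (\<lambda>x y. E x y \<and> x \<in> H \<and> y \<in> H)"
  have sym: "\<And>x y. E x y \<Longrightarrow> E y x" and irr: "\<And>x. \<not> E x x" and EV: "\<And>x y. E x y \<Longrightarrow> x \<in> V \<and> y \<in> V"
    using G unfolding graph_def by blast+
  have GH: "graph H E'" using G unfolding graph_def H_def E'_def by auto
  have mC: "maximal_clique V E C" and mS: "maximal_stable V E S" and CS: "C \<inter> S = {}"
    and uniq: "\<And>D T. maximal_clique V E D \<Longrightarrow> maximal_stable V E T \<Longrightarrow> D \<inter> T = {} \<Longrightarrow> D = C \<and> T = S"
    using P unfolding unique_disjoint_pair_def by blast+
  have CV: "C \<subseteq> V" and SV: "S \<subseteq> V" using mC mS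
    unfolding maximal_clique_def clique_def maximal_stable_def stable_def by blast+
  have Cclq: "\<And>x y. x \<in> C \<Longrightarrow> y \<in> C \<Longrightarrow> x \<noteq> y \<Longrightarrow> E x y"
    using mC unfolding maximal_clique_def clique_def by blast
  have CH: "C - {c} \<subseteq> H" using Cclq c CV unfolding H_def by blast
  have "card H < card V"
    by (rule psubset_card_mono) (use G c CV in \<open>auto simp: graph_def H_def\<close>)
  moreover have "u \<in> H" using u unfolding H_def by blast
  ultimately have "\<not> unique_disjoint_pair H E' (C - {c}) (S \<inter> H)"
    using IH[OF _ GH] u by blast
  moreover have "maximal_clique H E' (C - {c})"
  proof -
    have "v \<in> C - {c}" if v: "v \<in> H" "\<forall>a\<in>C-{c}. a = v \<or> E' a v" for v
    proof -
      have "\<forall>a\<in>C. a = v \<or> E a v" using v unfolding E'_def H_def by blast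
      then have "v \<in> C" using mC v unfolding maximal_clique_iff[OF G] H_def by blast
      then show ?thesis using v irr unfolding H_def by blast
    qed
    moreover have "clique H E' (C - {c})"
      using Cclq CH unfolding clique_def E'_def by blast
    ultimately show ?thesis unfolding maximal_clique_iff[OF GH] by blast
  qed
  moreover have "Q = C - {c} \<and> T = S \<inter> H"
    if Q: "maximal_clique H E' Q" and T: "maximal_stable H E' T" and QT: "Q \<inter> T = {}" for Q T
  proof -
    \<comment> \<open>A disjoint pair of \<open>H\<close> lifts to \<open>V\<close>: add
      \<open>c\<close> to the clique and extend the stable set maximally. Uniqueness in
      \<open>V\<close> then identifies the original pair.\<close>
    have mQ: "maximal_clique V E (insert c Q)"
      unfolding maximal_clique_iff[OF G]
    proof (intro conjI ballI impI)
      show "clique V E (insert c Q)"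
        using Q c CV sym unfolding maximal_clique_def clique_def H_def E'_def by auto
      show "v \<in> insert c Q" if "v \<in> V" "\<forall>a\<in>insert c Q. a = v \<or> E a v" for v
      proof (cases "v = c")
        case False
        then have "v \<in> H" using that unfolding H_def by auto
        moreover have "Q \<subseteq> H" using Q unfolding maximal_clique_def clique_def by blast
        ultimately have "\<forall>a\<in>Q. a = v \<or> E' a v" using that unfolding E'_def by blast
        then show ?thesis using Q \<open>v \<in> H\<close> unfolding maximal_clique_iff[OF GH] by blast
      qed simp
    qed
    have "stable V E T"
      using T unfolding maximal_stable_def stable_def E'_def H_def by blast
    then obtain T' where T': "maximal_stable V E T'" "T \<subseteq> T'" using stable_extends[OF G] by blast
    have T'H: "T' \<inter> H = T"
      using T T' unfolding maximal_stable_iff[OF GH] maximal_stable_iff[OF G]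
      unfolding stable_def E'_def by blast
    have "c \<notin> T'"
    proof
      assume "c \<in> T'"
      moreover have "\<forall>x\<in>T'. \<forall>y\<in>T'. \<not> E x y" "T \<subseteq> H"
        using T'(1) T unfolding maximal_stable_def stable_def by simp_all
      ultimately have "T = {}" using T'(2) unfolding H_def by blast
      then show False using T \<open>u \<in> H\<close> unfolding maximal_stable_iff[OF GH] by blast
    qed
    moreover have "Q \<subseteq> H" using Q unfolding maximal_clique_def clique_def by blast
    ultimately have "insert c Q \<inter> T' = {}" using T'H QT by blast
    then have "insert c Q = C \<and> T' = S" by (rule uniq[OF mQ T'(1)])
    moreover have "c \<notin> Q" using \<open>Q \<subseteq> H\<close> irr unfolding H_def by blast
    ultimately show ?thesis using T'H by blast
  qed
  ultimately have "\<not> maximal_stable H E' (S \<inter> H)"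
    using CS unfolding unique_disjoint_pair_def by blast
  moreover have "stable H E' (S \<inter> H)"
    using mS unfolding maximal_stable_def stable_def E'_def by blast
  ultimately obtain c' where c': "c' \<in> H" "c' \<notin> S" "\<forall>a\<in>S \<inter> H. \<not> E a c'"
    unfolding maximal_stable_iff[OF GH] unfolding E'_def by blast
  have cc': "E c c'" using c' unfolding H_def by blast
  \<comment> \<open>A maximal clique other than \<open>C\<close> meets \<open>S\<close>; if it
    contains \<open>c\<close> and \<open>c'\<close>, the common vertex is in
    \<open>S \<inter> H\<close> and adjacent to \<open>c'\<close>, which the choice of
    \<open>c'\<close> forbids.\<close>
  have no_common: "A \<subseteq> C" if A: "clique V E A" "c \<in> A" "c' \<in> A" for A
  proof (rule ccontr)
    assume "\<not> A \<subseteq> C"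
    moreover obtain D where D: "maximal_clique V E D" "A \<subseteq> D" using clique_extends[OF G A(1)] by blast
    ultimately obtain s where "s \<in> D" "s \<in> S" using uniq mS by blast
    then have "c \<in> D" "c' \<in> D" "c \<noteq> s" "s \<noteq> c'" using D A c c' CS by blast+
    then have "s \<in> V" "E c s" "E s c'"
      using D(1) \<open>s \<in> D\<close> unfolding maximal_clique_def clique_def by auto
    then show False using c' \<open>s \<in> S\<close> unfolding H_def by blast
  qed
  have "c' \<in> C" using no_common[of "{c,c'}"] cc' sym EV unfolding clique_def by blast
  moreover have "\<not> (E c y \<and> E c' y)" if "y \<in> V - C" for y
    using no_common[of "{c,c',y}"] that cc' sym EV unfolding clique_def by blast
  moreover have "c' \<noteq> c" using cc' irr by blast
  ultimately show ?thesis by blast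
qed

text \<open>Induction on the number of vertices, with the edge relation generalised: the hypothesis
  supplies mates in \<open>C\<close> directly and mates in \<open>S\<close> through the complement
  graph on the same vertex set.\<close>

lemma unique_disjoint_pair_covers:
  fixes V :: "'a set"
  assumes "graph V E" "unique_disjoint_pair V E C S"
  shows "V = C \<union> S"
  using assms
proof (induction "card V" arbitrary: V E C S rule: less_induct)
  case less
  note G = less.prems(1) and P = less.prems(2)
  have IH: "\<And>(V' :: 'a set) E' C' S'. card V' < card V \<Longrightarrow> graph V' E'
      \<Longrightarrow> unique_disjoint_pair V' E' C' S' \<Longrightarrow> V' = C' \<union> S'"
    using less.hyps by blast
  have mC: "maximal_clique V E C" and mS: "maximal_stable V E S" and CS: "C \<inter> S = {}"
    using P unfolding unique_disjoint_pair_def by blast+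
  interpret settled_pair V E "complement V E" C S
  proof unfold_locales
    show "finite V" using G unfolding graph_def by blast
    show "C \<subseteq> V" "S \<subseteq> V" "C \<inter> S = {}"
      using CS mC mS unfolding maximal_clique_def clique_def maximal_stable_def stable_def by blast+
    show "E x y" if "x \<in> C" "y \<in> C" "x \<noteq> y" for x y
      using mC that unfolding maximal_clique_def clique_def by blast
    show "complement V E x y" if "x \<in> S" "y \<in> S" "x \<noteq> y" for x y
      using mS that unfolding maximal_stable_def stable_def complement_def by blast
    show "\<exists>c\<in>C. complement V E v c" if "v \<in> V" "v \<notin> C" for v
      using mC that G unfolding maximal_clique_iff[OF G] clique_def complement_def graph_def by blast
    show "\<exists>s\<in>S. E v s" if "v \<in> V" "v \<notin> S" for v
      using mS that G unfolding maximal_stable_iff[OF G] graph_def by blast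
    show "\<exists>v\<in>V. (\<forall>a\<in>A. a = v \<or> E a v) \<and> (\<forall>b\<in>B. b = v \<or> complement V E b v)"
      if "A \<subseteq> V" "B \<subseteq> V" "\<forall>x\<in>A. \<forall>y\<in>A. x \<noteq> y \<longrightarrow> E x y"
        "\<forall>x\<in>B. \<forall>y\<in>B. x \<noteq> y \<longrightarrow> complement V E x y" "\<not> (A \<subseteq> C \<and> B \<subseteq> S)" for A B
    proof (rule pair_is_settled[OF G P _ _ that(5)])
      show "clique V E A" using that unfolding clique_def by blast
      show "stable V E B" using that(2,4) G unfolding stable_def complement_def graph_def by metis
    qed
    show "\<exists>c'\<in>C. c' \<noteq> c \<and> (\<forall>y\<in>V-C. \<not> (E c y \<and> E c' y))"
      if "c \<in> C" "u \<in> V - (C \<union> S)" "E c u" for c u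
      by (rule mate_exists[OF G P IH that])
    show "\<exists>s'\<in>S. s' \<noteq> s \<and> (\<forall>y\<in>V-S. \<not> (complement V E s y \<and> complement V E s' y))"
      if "s \<in> S" "u \<in> V - (C \<union> S)" "complement V E s u" for s u
    proof -
      have "u \<in> V - (S \<union> C)" using that by blast
      from mate_exists[OF graph_complement[OF G] unique_disjoint_pair_complement[OF G P] IH
          that(1) this that(3)]
      show ?thesis .
    qed
  qed (use G in \<open>auto simp: graph_def complement_def\<close>)
  show ?case by (rule covers)
qed

lemma almost_CIS_imp_split:
  assumes "graph V E" "almost_CIS V E"
  shows "split_graph V E"
proof -
  obtain C S where P: "unique_disjoint_pair V E C S"
    using assms(2) almost_CIS_iff by blast
  then have "V = C \<union> S" by (rule unique_disjoint_pair_covers[OF assms(1)])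
  moreover have "clique V E C" "stable V E S" "C \<inter> S = {}"
    using P unfolding unique_disjoint_pair_def maximal_clique_def maximal_stable_def by auto
  ultimately show ?thesis unfolding split_graph_def by metis
qed

section \<open>Edge simplicial graphs\<close>

lemma edge_simplicial_vertex_cover:
  assumes "graph V E" "edge_simplicial V E" "r \<in> V"
  obtains v where "v \<in> V" "clique V E (closed_nbhd V E v)" "r = v \<or> E v r"
proof (cases "\<exists>y. E r y")
  case True
  then show thesis using that assms(2)
    unfolding edge_simplicial_def simplicial_clique_def closed_nbhd_def by blast
next
  case False
  \<comment> \<open>An isolated vertex lies on no edge, but is itself simplicial.\<close>
  then have "clique V E (closed_nbhd V E r)"
    using assms(3) unfolding clique_def closed_nbhd_def by blast
  then show thesis using that assms(3) by blast
qed

text \<open>Take \<open>P\<close> maximal among stable sets of simplicial vertices. A simplicial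
  \<open>v\<close> outside \<open>P\<close> has a neighbour \<open>p\<close> in \<open>P\<close>,
  and since \<open>N[v]\<close> is a clique containing \<open>p\<close>, everything in it is also in
  \<open>N[p]\<close>.\<close>

lemma simplicial_transversal:
  assumes G: "graph V E" and ES: "edge_simplicial V E"
  obtains P where "stable V E P" "\<forall>p\<in>P. clique V E (closed_nbhd V E p)"
    "\<forall>r\<in>V. \<exists>p\<in>P. r = p \<or> E p r"
proof -
  let ?X = "{P. stable V E P \<and> (\<forall>p\<in>P. clique V E (closed_nbhd V E p))}"
  have "finite ?X"
    by (rule finite_subset[of _ "Pow V"]) (use G in \<open>auto simp: stable_def graph_def\<close>)
  moreover have "{} \<in> ?X" unfolding stable_def by blast
  ultimately obtain P where P: "P \<in> ?X" "\<forall>P'\<in>?X. P \<subseteq> P' \<longrightarrow> P = P'"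
    using finite_has_maximal2[of ?X "{}"] by blast
  have sym: "\<And>x y. E x y \<Longrightarrow> E y x" and irr: "\<And>x. \<not> E x x" and EV: "\<And>x y. E x y \<Longrightarrow> x \<in> V \<and> y \<in> V"
    using G unfolding graph_def by blast+
  have "\<exists>p\<in>P. r = p \<or> E p r" if r: "r \<in> V" for r
  proof -
    obtain v where v: "v \<in> V" "clique V E (closed_nbhd V E v)" "r = v \<or> E v r"
      using edge_simplicial_vertex_cover[OF G ES r] .
    show ?thesis
    proof (cases "v \<in> P")
      case True
      then show ?thesis using v by blast
    next
      case False
      then have "\<not> stable V E (insert v P)" using P v(2) by blast
      then obtain p where p: "p \<in> P" "E v p"
        using P(1) v(1) irr sym unfolding stable_def by blast
      then have "p \<in> closed_nbhd V E v" "r \<in> closed_nbhd V E v"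
        using v EV unfolding closed_nbhd_def by blast+
      then have "r = p \<or> E p r" using v(2) unfolding clique_def by metis
      then show ?thesis using p by blast
    qed
  qed
  then show thesis using that P(1) by blast
qed

lemma cap_edge_simplicial_imp_split:
  assumes G: "graph V E" and ES: "cap_edge_simplicial V E"
  shows "split_graph V E"
proof -
  have sym: "\<And>x y. E x y \<Longrightarrow> E y x" and irr: "\<And>x. \<not> E x x"
    using G unfolding graph_def by blast+
  obtain P where P: "stable V E P" "\<forall>p\<in>P. clique V E (closed_nbhd V E p)"
    "\<forall>r\<in>V. \<exists>p\<in>P. r = p \<or> E p r"
    using simplicial_transversal[OF G] ES unfolding cap_edge_simplicial_def by blast
  obtain Q where Q': "stable V (complement V E) Q"
    "\<forall>q\<in>Q. clique V (complement V E) (closed_nbhd V (complement V E) q)"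
    "\<forall>r\<in>V. \<exists>q\<in>Q. r = q \<or> complement V E q r"
    using simplicial_transversal[OF graph_complement[OF G]] ES
    unfolding cap_edge_simplicial_def by blast
  have Q: "clique V E Q" "\<forall>q\<in>Q. stable V E {r\<in>V. \<not> E q r}"
    "\<forall>r\<in>V. \<exists>q\<in>Q. \<not> E q r"
  proof -
    show Q1: "clique V E Q" using Q'(1) stable_complement[OF G] by blast
    have "closed_nbhd V (complement V E) q = {r\<in>V. \<not> E q r}" if "q \<in> Q" for q
      using Q1 that irr unfolding clique_def closed_nbhd_def complement_def by blast
    then show "\<forall>q\<in>Q. stable V E {r\<in>V. \<not> E q r}"
      using Q'(2) clique_complement[OF G] by metis
    show "\<forall>r\<in>V. \<exists>q\<in>Q. \<not> E q r"
      using Q'(3) irr unfolding complement_def by blast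
  qed
  have PV: "P \<subseteq> V" and QV: "Q \<subseteq> V" using P(1) Q(1) unfolding stable_def clique_def by blast+
  show ?thesis
  proof (cases "P \<inter> Q = {}")
    case False
    \<comment> \<open>Such a vertex is both simplicial and co-simplicial, so its closed
      neighbourhood and the remaining vertices form a split partition.\<close>
    then obtain v where v: "v \<in> P" "v \<in> Q" by blast
    have "clique V E (closed_nbhd V E v)" using P v by blast
    moreover have "stable V E (V - closed_nbhd V E v)"
      using Q(2) v unfolding stable_def closed_nbhd_def by blast
    moreover have "closed_nbhd V E v \<union> (V - closed_nbhd V E v) = V"
      "closed_nbhd V E v \<inter> (V - closed_nbhd V E v) = {}"
      using v PV unfolding closed_nbhd_def by blast+
    ultimately show ?thesis unfolding split_graph_def by metis
  next
    case True
    have "r \<in> P \<union> Q" if r: "r \<in> V" for r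
    proof -
      obtain p q where p: "p \<in> P" "r = p \<or> E p r" and q: "q \<in> Q" "\<not> E q r"
        using P(3) Q(3) r by blast
      show ?thesis
      \<comment> \<open>If \<open>p\<close> and \<open>q\<close> are adjacent, both \<open>q\<close>
        and \<open>r\<close> lie in the clique \<open>N[p]\<close>, so \<open>r = q\<close>.
        Otherwise \<open>p\<close> and \<open>r\<close> lie in the stable set of non-neighbours of
        \<open>q\<close>, so \<open>r = p\<close>.\<close>
      proof (cases "E p q")
        case True
        then have "q \<in> closed_nbhd V E p" "r \<in> closed_nbhd V E p"
          using p q r QV unfolding closed_nbhd_def by blast+
        then have "r = q" using P(2) p(1) q(2) unfolding clique_def by metis
        then show ?thesis using q by blast
      next
        case False
        then have "p \<in> {r\<in>V. \<not> E q r}" "r \<in> {r\<in>V. \<not> E q r}" using p q r PV sym by blast+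
        then have "\<not> E p r" using Q(2) q unfolding stable_def by blast
        then show ?thesis using p by blast
      qed
    qed
    then have "Q \<union> P = V" using PV QV by blast
    then show ?thesis using True P(1) Q(1) unfolding split_graph_def by blast
  qed
qed

section \<open>Split graphs\<close>

text \<open>If \<open>D\<close> contained some \<open>s\<close> of \<open>S\<close>, the rest of
  \<open>D\<close> would lie in \<open>K\<close>. As \<open>s\<close> is outside \<open>T\<close>,
  it has a neighbour \<open>t\<close> in \<open>T\<close>, necessarily in \<open>K\<close>; then
  \<open>t\<close> is adjacent to all of \<open>D\<close> and so belongs to it, contradicting
  disjointness. Hence \<open>D = K\<close>, which leaves only \<open>S\<close> for
  \<open>T\<close>.\<close>

lemma unique_disjoint_pair_if_maximal_split:
  assumes G: "graph V E" and V: "V = K \<union> S" "K \<inter> S = {}"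
    and K: "maximal_clique V E K" and S: "maximal_stable V E S"
  shows "unique_disjoint_pair V E K S"
proof -
  have sym: "\<And>x y. E x y \<Longrightarrow> E y x" and irr: "\<And>x. \<not> E x x"
    using G unfolding graph_def by blast+
  have "D = K \<and> T = S"
    if D: "maximal_clique V E D" and T: "maximal_stable V E T" and DT: "D \<inter> T = {}" for D T
  proof -
    note D' = D[unfolded maximal_clique_iff[OF G] clique_def]
    note T' = T[unfolded maximal_stable_iff[OF G] stable_def]
    have "D \<subseteq> K"
    proof (rule ccontr)
      assume "\<not> D \<subseteq> K"
      then obtain s where s: "s \<in> D" "s \<in> S" using D' V by blast
      then have "s \<notin> T" "s \<in> V" using DT V by blast+
      then obtain t where t: "t \<in> T" "E t s" using T' by blast
      have "t \<in> K" using t s T' V S unfolding maximal_stable_def stable_def by blast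
      have "D - {s} \<subseteq> K"
      proof
        fix y assume y: "y \<in> D - {s}"
        then have "E s y" using s D' by auto
        moreover have "y \<in> K \<union> S" using y D' V(1) by blast
        ultimately show "y \<in> K" using s S unfolding maximal_stable_def stable_def by blast
      qed
      then have "\<forall>a\<in>D. a = t \<or> E a t"
        using t \<open>t \<in> K\<close> K sym unfolding maximal_clique_def clique_def by blast
      then have "t \<in> D" using D' T' t by blast
      then show False using DT t by blast
    qed
    then have "D = K" using D K unfolding maximal_clique_def by blast
    moreover from this have "T \<subseteq> S" using DT T' V by blast
    then have "T = S" using T S unfolding maximal_stable_def by blast
    ultimately show ?thesis by blast
  qed
  then show ?thesis using assms unfolding unique_disjoint_pair_def by blast
qed

text \<open>Every vertex of \<open>S\<close> is simplicial because its neighbours lie in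
  \<open>K\<close>, which handles edges with an end in \<open>S\<close>. The clique
  \<open>N[v]\<close> handles the edges inside \<open>K\<close>.\<close>

lemma edge_simplicial_if_split:
  assumes G: "graph V E" and V: "V = K \<union> S" "clique V E K" "stable V E S"
    and k: "v \<in> V" "K \<subseteq> closed_nbhd V E v" "clique V E (closed_nbhd V E v)"
  shows "edge_simplicial V E"
  unfolding edge_simplicial_def
proof (intro allI impI)
  fix x y assume xy: "E x y"
  have sym: "\<And>x y. E x y \<Longrightarrow> E y x" and irr: "\<And>x. \<not> E x x" and EV: "\<And>x y. E x y \<Longrightarrow> x \<in> V \<and> y \<in> V"
    using G unfolding graph_def by blast+
  have sim: "simplicial_clique V E (closed_nbhd V E s)" if "s \<in> S" for s
  proof -
    have "{u\<in>V. E s u} \<subseteq> K" using that V unfolding stable_def by blast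
    then have "clique V E (closed_nbhd V E s)"
      using that V sym unfolding clique_def closed_nbhd_def by blast
    then show ?thesis using that V unfolding simplicial_clique_def by blast
  qed
  have nb: "x \<in> closed_nbhd V E x" "y \<in> closed_nbhd V E x" "x \<in> closed_nbhd V E y"
    "y \<in> closed_nbhd V E y"
    using xy sym EV unfolding closed_nbhd_def by blast+
  consider "x \<in> S" | "y \<in> S" | "x \<in> K" "y \<in> K" using EV[OF xy] V by blast
  then show "\<exists>C. simplicial_clique V E C \<and> x \<in> C \<and> y \<in> C"
  proof cases
    case 3
    then show ?thesis using k unfolding simplicial_clique_def by blast
  qed (use sim nb in blast)+
qed

text \<open>
  If \<open>K\<close> or \<open>S\<close> is not maximal, the two sides overlap after enlarging one of them by a vertex
  \<open>v\<close>, which is then both simplicial and co-simplicial.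
\<close>

lemma cap_edge_simplicial_if_overlapping_split:
  assumes G: "graph V E" and V: "V = K \<union> S" "clique V E K" "stable V E S" and v: "v \<in> K" "v \<in> S"
  shows "cap_edge_simplicial V E"
proof -
  have VKS: "u \<in> V \<longleftrightarrow> u \<in> K \<or> u \<in> S" for u using V(1) by blast
  have vS: "\<not> E v u" if "u \<in> S" for u using V(3) v that unfolding stable_def by blast
  have vK: "u = v \<or> E v u" if "u \<in> K" for u using V(2) v that unfolding clique_def by auto
  have K: "closed_nbhd V E v = K"
    using vK vS v(1) by (auto simp: closed_nbhd_def VKS)
  have S: "closed_nbhd V (complement V E) v = S"
    using vK vS v by (auto simp: closed_nbhd_def complement_def VKS)
  have "v \<in> V" "V = S \<union> K" using v V(1) by blast+
  have "edge_simplicial V E"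
    by (rule edge_simplicial_if_split[OF G V \<open>v \<in> V\<close>]) (simp_all only: K V(2) order_refl)
  moreover have "edge_simplicial V (complement V E)"
    by (rule edge_simplicial_if_split[OF graph_complement[OF G] \<open>V = S \<union> K\<close> _ _ \<open>v \<in> V\<close>])
      (simp_all only: S V(2,3) clique_complement[OF G] stable_complement[OF G] order_refl)
  ultimately show ?thesis unfolding cap_edge_simplicial_def by blast
qed

lemma split_imp_almost_CIS_or_cap_edge_simplicial:
  assumes G: "graph V E" and "split_graph V E"
  shows "almost_CIS V E \<or> cap_edge_simplicial V E"
proof -
  have sym: "\<And>x y. E x y \<Longrightarrow> E y x" and irr: "\<And>x. \<not> E x x"
    using G unfolding graph_def by blast+
  obtain K S where V: "V = K \<union> S" "K \<inter> S = {}" and K: "clique V E K" and S: "stable V E S"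
    using assms(2) unfolding split_graph_def by blast
  consider "maximal_clique V E K" "maximal_stable V E S"
    | v where "v \<in> V" "\<forall>a\<in>K. a = v \<or> E a v" "v \<notin> K"
    | v where "v \<in> V" "\<forall>a\<in>S. \<not> E a v" "v \<notin> S"
    using K S maximal_clique_iff[OF G, of K] maximal_stable_iff[OF G, of S] by blast
  then show ?thesis
  proof cases
    case 1
    then show ?thesis using unique_disjoint_pair_if_maximal_split[OF G V] almost_CIS_iff by blast
  next
    case (2 v)
    \<comment> \<open>Being outside \<open>K\<close>, the vertex \<open>v\<close> is in
      \<open>S\<close>, so the enlarged clique overlaps \<open>S\<close> in
      \<open>v\<close>.\<close>
    then have "clique V E (insert v K)" using K sym unfolding clique_def by auto
    then have "cap_edge_simplicial V E"
      using cap_edge_simplicial_if_overlapping_split[OF G _ _ S, of "insert v K" v] V 2 by blast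
    then show ?thesis ..
  next
    case (3 v)
    then have "stable V E (insert v S)" using S sym irr unfolding stable_def by blast
    then have "cap_edge_simplicial V E"
      using cap_edge_simplicial_if_overlapping_split[OF G _ K, of "insert v S" v] V 3 by blast
    then show ?thesis ..
  qed
qed

theorem theorem28:
  fixes V :: "'a set" and E :: "'a \<Rightarrow> 'a \<Rightarrow> bool"
  assumes "graph V E"
  shows "split_graph V E \<longleftrightarrow> almost_CIS V E \<or> cap_edge_simplicial V E"
  using split_imp_almost_CIS_or_cap_edge_simplicial[OF assms] almost_CIS_imp_split[OF assms]
    cap_edge_simplicial_imp_split[OF assms] by blast

end
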